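(* Let $F$ be a fuzzy propositional formula of signature $\sigma$ that contains no strong negation (and whose only fuzzy negation operator is $\neg_s(x)=1-x$). (a) A valuation $V$ of $\sigma$ is a fuzzy equilibrium model of $F$ if and only if $V^-(h,p)=V^-(t,p)$ and $V^+(h,p)=V^+(t,p)=1$ for all atoms $p\in\sigma$ and $\mathsf{I}_V$ is a stable model of $F$ relative to $\sigma$. (b) An interpretation $I$ of $\sigma$ is a stable model of $F$ relative to $\sigma$ if and only if $I=\mathsf{I}_V$ for some fuzzy equilibrium model $V$ of $F$.
   Context: Fuzzy formulas. A signature $\sigma$ is a set of symbols (fuzzy atoms). Fuzzy formulas (without strong negation) are built from atoms of $\sigma$ and numeric constants $c\in[0,1]$ using the fuzzy negation $\neg=\neg_s$, $\neg_s(x)=1-x$, fuzzy conjunctions $\otimes$, disjunctions $\oplus$ and implications $\rightarrow$ (several different ones may occur), identified with functions $[0,1]^2\to[0,1]$ such that (monotonicity being non-strict): $\otimes$ is increasing in both arguments, commutative, associative, $\otimes(1,x)=x$; $\oplus$ is increasing in both arguments, commutative, associative, $\oplus(0,x)=x$; $\rightarrow$ is decreasing in its first and increasing in its second argument, $\rightarrow\!(1,x)=x$, $\rightarrow\!(0,0)=1$. $\otimes_m$ is $\min$. Infix notation is used for values as well. Stable models. An interpretation is a map $I:\sigma\to[0,1]$; $\upsilon_I(p)=I(p)$, $\upsilon_I(c)=c$, $\upsilon_I(\neg F)=1-\upsilon_I(F)$, $\upsilon_I(F\odot G)=\upsilon_I(F)\odot\upsilon_I(G)$; $I\models F$ means $\upsilon_I(F)=1$.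 Reduct: $F^I=F$ for atoms and constants; $(\neg F)^I=\upsilon_I(\neg F)$; $(F\odot G)^I=(F^I\odot G^I)\otimes_m\upsilon_I(F\odot G)$ for $\odot\in\{\otimes,\oplus,\rightarrow\}$. $I$ is a stable model of $F$ relative to $\sigma$ if $I\models F$ and there is no interpretation $J\neq I$ with $J(p)\le I(p)$ for all $p\in\sigma$ and $J\models F^I$. Fuzzy equilibrium logic. A (fuzzy N5) valuation $V$ of $\sigma$ maps $\{h,t\}\times\sigma$ to closed subintervals of $[0,1]$ with $V(t,a)\subseteq V(h,a)$ for each $a\in\sigma$. $V^-$ and $V^+$ denote lower and upper bounds of the interval. $V$ is extended to formulas ($w\in\{h,t\}$) by: $V(w,c)=[c,c]$; $V(w,F\odot G)=[V^-(w,F)\odot V^-(w,G),\,V^+(w,F)\odot V^+(w,G)]$ for $\odot\in\{\otimes,\oplus\}$; $V(h,\neg F)=[1-V^-(t,F),\,1-V^-(h,F)]$; $V(t,\neg F)=[1-V^-(t,F),\,1-V^-(t,F)]$; $V(h,F\rightarrow G)=[\min(V^-(h,F)\rightarrow V^-(h,G),\,V^-(t,F)\rightarrow V^-(t,G)),\ V^-(h,F)\rightarrow V^+(h,G)]$; $V(t,F\rightarrow G)=[V^-(t,F)\rightarrow V^-(t,G),\,V^-(t,F)\rightarrow V^+(t,G)]$. $V$ is a model of $F$ if $V^-(h,F)=1$. $V'\preceq V$ means $V'(t,a)=V(t,a)$ and $V(h,a)\subseteq V'(h,a)$ for all atoms $a$; $V'\prec V$ means $V'\preceq V$ and $V'\ne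 V$. A model $V$ of $F$ is h-minimal if there is no model $V'$ of $F$ with $V'\prec V$. A fuzzy equilibrium model of $F$ is an h-minimal model $V$ of $F$ with $V(h,a)=V(t,a)$ for all atoms $a$. For a valuation $V$, the interpretation $\mathsf{I}_V$ of $\sigma$ is $\mathsf{I}_V(p)=V^-(h,p)$ for $p\in\sigma$. *)

theory Defs
  imports "HOL-Library.FuncSet" "HOL-Library.Interval"
begin

section \<open>Fuzzy formulas\<close>

text \<open>
  Operators are total functions on the reals; only their behaviour on the unit square is
  constrained, and only that behaviour is ever observed.
\<close>

definition fuzzy_conj :: "(real \<Rightarrow> real \<Rightarrow> real) \<Rightarrow> bool" where
  "fuzzy_conj c \<longleftrightarrow>
     (\<forall>x\<in>{0..1}. \<forall>y\<in>{0..1}. c x y \<in> {0..1}) \<and>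
     (\<forall>y\<in>{0..1}. mono_on {0..1} (\<lambda>x. c x y)) \<and>
     (\<forall>x\<in>{0..1}. mono_on {0..1} (\<lambda>y. c x y)) \<and>
     (\<forall>x\<in>{0..1}. \<forall>y\<in>{0..1}. c x y = c y x) \<and>
     (\<forall>x\<in>{0..1}. \<forall>y\<in>{0..1}. \<forall>z\<in>{0..1}. c (c x y) z = c x (c y z)) \<and>
     (\<forall>x\<in>{0..1}. c 1 x = x)"

definition fuzzy_disj :: "(real \<Rightarrow> real \<Rightarrow> real) \<Rightarrow> bool" where
  "fuzzy_disj d \<longleftrightarrow>
     (\<forall>x\<in>{0..1}. \<forall>y\<in>{0..1}. d x y \<in> {0..1}) \<and>
     (\<forall>y\<in>{0..1}. mono_on {0..1} (\<lambda>x. d x y)) \<and>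
     (\<forall>x\<in>{0..1}. mono_on {0..1} (\<lambda>y. d x y)) \<and>
     (\<forall>x\<in>{0..1}. \<forall>y\<in>{0..1}. d x y = d y x) \<and>
     (\<forall>x\<in>{0..1}. \<forall>y\<in>{0..1}. \<forall>z\<in>{0..1}. d (d x y) z = d x (d y z)) \<and>
     (\<forall>x\<in>{0..1}. d 0 x = x)"

definition fuzzy_imp :: "(real \<Rightarrow> real \<Rightarrow> real) \<Rightarrow> bool" where
  "fuzzy_imp i \<longleftrightarrow>
     (\<forall>x\<in>{0..1}. \<forall>y\<in>{0..1}. i x y \<in> {0..1}) \<and>
     (\<forall>y\<in>{0..1}. antimono_on {0..1} (\<lambda>x. i x y)) \<and>
     (\<forall>x\<in>{0..1}. mono_on {0..1} (\<lambda>y. i x y)) \<and>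
     (\<forall>x\<in>{0..1}. i 1 x = x) \<and>
     i 0 0 = 1"

datatype 'a formula =
    Atom 'a
  | Const real
  | Neg "'a formula"
  | Conj "real \<Rightarrow> real \<Rightarrow> real" "'a formula" "'a formula"
  | Disj "real \<Rightarrow> real \<Rightarrow> real" "'a formula" "'a formula"
  | Imp "real \<Rightarrow> real \<Rightarrow> real" "'a formula" "'a formula"

primrec fuzzy_formula :: "'a set \<Rightarrow> 'a formula \<Rightarrow> bool" where
  "fuzzy_formula \<sigma> (Atom p) \<longleftrightarrow> p \<in> \<sigma>"
| "fuzzy_formula \<sigma> (Const c) \<longleftrightarrow> c \<in> {0..1}"
| "fuzzy_formula \<sigma> (Neg F) \<longleftrightarrow> fuzzy_formula \<sigma> F"
| "fuzzy_formula \<sigma> (Conj f F G) \<longleftrightarrow> fuzzy_conj f \<and> fuzzy_formula \<sigma> F \<and> fuzzy_formula \<sigma> G"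
| "fuzzy_formula \<sigma> (Disj f F G) \<longleftrightarrow> fuzzy_disj f \<and> fuzzy_formula \<sigma> F \<and> fuzzy_formula \<sigma> G"
| "fuzzy_formula \<sigma> (Imp f F G) \<longleftrightarrow> fuzzy_imp f \<and> fuzzy_formula \<sigma> F \<and> fuzzy_formula \<sigma> G"


section \<open>Stable models\<close>

text \<open>
  Interpretations and valuations are extensional functions on the signature, so that equality
  of functions is equality on the signature.
\<close>

definition interpretations :: "'a set \<Rightarrow> ('a \<Rightarrow> real) set" where
  "interpretations \<sigma> = \<sigma> \<rightarrow>\<^sub>E {0..1}"

primrec truth_value :: "('a \<Rightarrow> real) \<Rightarrow> 'a formula \<Rightarrow> real" where
  "truth_value I (Atom p) = I p"
| "truth_value I (Const c) = c"
| "truth_value I (Neg F) = 1 - truth_value I F"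
| "truth_value I (Conj f F G) = f (truth_value I F) (truth_value I G)"
| "truth_value I (Disj f F G) = f (truth_value I F) (truth_value I G)"
| "truth_value I (Imp f F G) = f (truth_value I F) (truth_value I G)"

definition satisfies :: "('a \<Rightarrow> real) \<Rightarrow> 'a formula \<Rightarrow> bool" where
  "satisfies I F \<longleftrightarrow> truth_value I F = 1"

primrec reduct :: "('a \<Rightarrow> real) \<Rightarrow> 'a formula \<Rightarrow> 'a formula" where
  "reduct I (Atom p) = Atom p"
| "reduct I (Const c) = Const c"
| "reduct I (Neg F) = Const (truth_value I (Neg F))"
| "reduct I (Conj f F G) =
     Conj min (Conj f (reduct I F) (reduct I G)) (Const (truth_value I (Conj f F G)))"
| "reduct I (Disj f F G) =
     Conj min (Disj f (reduct I F) (reduct I G)) (Const (truth_value I (Disj f F G)))"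
| "reduct I (Imp f F G) =
     Conj min (Imp f (reduct I F) (reduct I G)) (Const (truth_value I (Imp f F G)))"

definition stable_model :: "'a set \<Rightarrow> 'a formula \<Rightarrow> ('a \<Rightarrow> real) \<Rightarrow> bool" where
  "stable_model \<sigma> F I \<longleftrightarrow>
     I \<in> interpretations \<sigma> \<and> satisfies I F \<and>
     \<not> (\<exists>J \<in> interpretations \<sigma>. J \<noteq> I \<and> (\<forall>p\<in>\<sigma>. J p \<le> I p) \<and> satisfies J (reduct I F))"


section \<open>Fuzzy equilibrium logic\<close>

datatype world = Here | There

definition valuations :: "'a set \<Rightarrow> (world \<times> 'a \<Rightarrow> real interval) set" where
  "valuations \<sigma> =
     {V \<in> (UNIV \<times> \<sigma>) \<rightarrow>\<^sub>E {i. set_of i \<subseteq> {0..1}}.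
        \<forall>a\<in>\<sigma>. set_of (V (There, a)) \<subseteq> set_of (V (Here, a))}"

text \<open>
  The type of intervals contains only non-empty intervals, so \<^term>\<open>Interval (l, u)\<close> is
  meaningful only if \<^prop>\<open>l \<le> u\<close>. The lemmas \<open>ext_valuation_nested\<close> and
  \<open>ext_valuation_bounds\<close> below show that this always holds for valuations and fuzzy formulas.
\<close>

fun ext_valuation ::
  "(world \<times> 'a \<Rightarrow> real interval) \<Rightarrow> world \<Rightarrow> 'a formula \<Rightarrow> real interval" where
  "ext_valuation V w (Atom p) = V (w, p)"
| "ext_valuation V w (Const c) = Interval (c, c)"
| "ext_valuation V w (Conj f F G) =
     Interval (f (lower (ext_valuation V w F)) (lower (ext_valuation V w G)),
               f (upper (ext_valuation V w F)) (upper (ext_valuation V w G)))"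
| "ext_valuation V w (Disj f F G) =
     Interval (f (lower (ext_valuation V w F)) (lower (ext_valuation V w G)),
               f (upper (ext_valuation V w F)) (upper (ext_valuation V w G)))"
| "ext_valuation V Here (Neg F) =
     Interval (1 - lower (ext_valuation V There F), 1 - lower (ext_valuation V Here F))"
| "ext_valuation V There (Neg F) =
     Interval (1 - lower (ext_valuation V There F), 1 - lower (ext_valuation V There F))"
| "ext_valuation V Here (Imp f F G) =
     Interval (min (f (lower (ext_valuation V Here F)) (lower (ext_valuation V Here G)))
                   (f (lower (ext_valuation V There F)) (lower (ext_valuation V There G))),
               f (lower (ext_valuation V Here F)) (upper (ext_valuation V Here G)))"
| "ext_valuation V There (Imp f F G) =
     Interval (f (lower (ext_valuation V There F)) (lower (ext_valuation V There G)),
               f (lower (ext_valuation V There F)) (upper (ext_valuation V There G)))"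

definition eq_model :: "'a set \<Rightarrow> 'a formula \<Rightarrow> (world \<times> 'a \<Rightarrow> real interval) \<Rightarrow> bool" where
  "eq_model \<sigma> F V \<longleftrightarrow> V \<in> valuations \<sigma> \<and> lower (ext_valuation V Here F) = 1"

definition val_preceq ::
  "'a set \<Rightarrow> (world \<times> 'a \<Rightarrow> real interval) \<Rightarrow> (world \<times> 'a \<Rightarrow> real interval) \<Rightarrow> bool" where
  "val_preceq \<sigma> V' V \<longleftrightarrow>
     (\<forall>a\<in>\<sigma>. V' (There, a) = V (There, a) \<and> set_of (V (Here, a)) \<subseteq> set_of (V' (Here, a)))"

definition val_prec ::
  "'a set \<Rightarrow> (world \<times> 'a \<Rightarrow> real interval) \<Rightarrow> (world \<times> 'a \<Rightarrow> real interval) \<Rightarrow> bool" where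
  "val_prec \<sigma> V' V \<longleftrightarrow> val_preceq \<sigma> V' V \<and> V' \<noteq> V"

definition h_minimal_model ::
  "'a set \<Rightarrow> 'a formula \<Rightarrow> (world \<times> 'a \<Rightarrow> real interval) \<Rightarrow> bool" where
  "h_minimal_model \<sigma> F V \<longleftrightarrow>
     eq_model \<sigma> F V \<and> \<not> (\<exists>V'. eq_model \<sigma> F V' \<and> val_prec \<sigma> V' V)"

definition fuzzy_equilibrium_model ::
  "'a set \<Rightarrow> 'a formula \<Rightarrow> (world \<times> 'a \<Rightarrow> real interval) \<Rightarrow> bool" where
  "fuzzy_equilibrium_model \<sigma> F V \<longleftrightarrow>
     h_minimal_model \<sigma> F V \<and> (\<forall>a\<in>\<sigma>. V (Here, a) = V (There, a))"

definition interp_of_valuation ::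
  "'a set \<Rightarrow> (world \<times> 'a \<Rightarrow> real interval) \<Rightarrow> 'a \<Rightarrow> real" where
  "interp_of_valuation \<sigma> V = (\<lambda>p\<in>\<sigma>. lower (V (Here, p)))"


section \<open>Well-definedness of the extended valuation\<close>

lemma lower_upper_Interval:
  assumes "l \<le> (u::real)"
  shows "lower (Interval (l, u)) = l" "upper (Interval (l, u)) = u"
  using assms by (simp_all add: lower.rep_eq upper.rep_eq Interval_inverse)

lemma fuzzy_conj_mono:
  assumes "fuzzy_conj f" "0 \<le> x" "x \<le> x'" "x' \<le> 1" "0 \<le> y" "y \<le> y'" "y' \<le> 1"
  shows "f x y \<le> f x' y'"
proof -
  have "f x y \<le> f x' y" using assms by (auto simp: fuzzy_conj_def monotone_on_def)
  also have "\<dots> \<le> f x' y'" using assms by (auto simp: fuzzy_conj_def monotone_on_def)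
  finally show ?thesis .
qed

lemma fuzzy_disj_mono:
  assumes "fuzzy_disj f" "0 \<le> x" "x \<le> x'" "x' \<le> 1" "0 \<le> y" "y \<le> y'" "y' \<le> 1"
  shows "f x y \<le> f x' y'"
proof -
  have "f x y \<le> f x' y" using assms by (auto simp: fuzzy_disj_def monotone_on_def)
  also have "\<dots> \<le> f x' y'" using assms by (auto simp: fuzzy_disj_def monotone_on_def)
  finally show ?thesis .
qed

lemma fuzzy_imp_mono:
  assumes "fuzzy_imp f" "0 \<le> x'" "x' \<le> x" "x \<le> 1" "0 \<le> y" "y \<le> y'" "y' \<le> 1"
  shows "f x y \<le> f x' y'"
proof -
  have "f x y \<le> f x' y" using assms by (auto simp: fuzzy_imp_def monotone_on_def)
  also have "\<dots> \<le> f x' y'" using assms by (auto simp: fuzzy_imp_def monotone_on_def)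
  finally show ?thesis .
qed

lemma fuzzy_conj_chain:
  assumes "fuzzy_conj f"
    and "0 \<le> a \<and> a \<le> b \<and> b \<le> c \<and> c \<le> d \<and> d \<le> 1"
    and "0 \<le> a' \<and> a' \<le> b' \<and> b' \<le> c' \<and> c' \<le> d' \<and> d' \<le> 1"
  shows "0 \<le> f a a' \<and> f a a' \<le> f b b' \<and> f b b' \<le> f c c' \<and> f c c' \<le> f d d' \<and> f d d' \<le> 1 \<and>
    f a a' \<le> f d d'"
proof -
  have "0 \<le> f a a'" "f d d' \<le> 1"
    using assms by (auto simp: fuzzy_conj_def)
  moreover have "f a a' \<le> f b b'" "f b b' \<le> f c c'" "f c c' \<le> f d d'"
    by (rule fuzzy_conj_mono[OF assms(1)]; use assms in linarith)+
  ultimately show ?thesis by linarith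
qed

lemma fuzzy_disj_chain:
  assumes "fuzzy_disj f"
    and "0 \<le> a \<and> a \<le> b \<and> b \<le> c \<and> c \<le> d \<and> d \<le> 1"
    and "0 \<le> a' \<and> a' \<le> b' \<and> b' \<le> c' \<and> c' \<le> d' \<and> d' \<le> 1"
  shows "0 \<le> f a a' \<and> f a a' \<le> f b b' \<and> f b b' \<le> f c c' \<and> f c c' \<le> f d d' \<and> f d d' \<le> 1 \<and>
    f a a' \<le> f d d'"
proof -
  have "0 \<le> f a a'" "f d d' \<le> 1"
    using assms by (auto simp: fuzzy_disj_def)
  moreover have "f a a' \<le> f b b'" "f b b' \<le> f c c'" "f c c' \<le> f d d'"
    by (rule fuzzy_disj_mono[OF assms(1)]; use assms in linarith)+
  ultimately show ?thesis by linarith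
qed

lemma fuzzy_imp_chain:
  assumes "fuzzy_imp f"
    and "0 \<le> a \<and> a \<le> b \<and> b \<le> c \<and> c \<le> d \<and> d \<le> 1"
    and "0 \<le> a' \<and> a' \<le> b' \<and> b' \<le> c' \<and> c' \<le> d' \<and> d' \<le> 1"
  shows "0 \<le> f a a' \<and> 0 \<le> f b b' \<and> f a a' \<le> f a d' \<and> f b b' \<le> f b c' \<and> f b c' \<le> f a d' \<and>
    f a d' \<le> 1"
proof -
  have "0 \<le> f a a'" "0 \<le> f b b'" "f a d' \<le> 1"
    using assms by (auto simp: fuzzy_imp_def)
  moreover have "f a a' \<le> f a d'" "f b b' \<le> f b c'" "f b c' \<le> f a d'"
    by (rule fuzzy_imp_mono[OF assms(1)]; use assms in linarith)+
  ultimately show ?thesis by linarith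
qed

lemma ext_valuation_nested:
  assumes V: "V \<in> valuations \<sigma>" and F: "fuzzy_formula \<sigma> F"
  shows "0 \<le> lower (ext_valuation V Here F) \<and>
      lower (ext_valuation V Here F) \<le> lower (ext_valuation V There F) \<and>
      lower (ext_valuation V There F) \<le> upper (ext_valuation V There F) \<and>
      upper (ext_valuation V There F) \<le> upper (ext_valuation V Here F) \<and>
      upper (ext_valuation V Here F) \<le> 1"
  using F
proof (induction F)
  case (Atom p)
  then have "set_of (V (There, p)) \<subseteq> set_of (V (Here, p))" "set_of (V (Here, p)) \<subseteq> {0..1}"
    using V by (auto simp: valuations_def PiE_iff)
  then show ?case by (simp add: set_of_eq)
next
  case (Const c)
  then show ?case by (simp add: lower_upper_Interval)
next
  case (Neg F)
  moreover from Neg have "lower (ext_valuation V There F) \<le> 1"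
    by (metis fuzzy_formula.simps(3) order_trans)
  ultimately show ?case by (simp add: lower_upper_Interval)
next
  case (Conj f F G)
  then show ?case
    using fuzzy_conj_chain[of f, OF _ Conj.IH] by (simp add: lower_upper_Interval)
next
  case (Disj f F G)
  then show ?case
    using fuzzy_disj_chain[of f, OF _ Disj.IH] by (simp add: lower_upper_Interval)
next
  case (Imp f F G)
  then show ?case
    using fuzzy_imp_chain[of f, OF _ Imp.IH] by (simp add: lower_upper_Interval min.coboundedI1)
qed

lemma ext_valuation_bounds:
  assumes V: "V \<in> valuations \<sigma>"
  shows "fuzzy_formula \<sigma> (Const c) \<Longrightarrow> lower (ext_valuation V w (Const c)) = c"
    and "fuzzy_formula \<sigma> (Const c) \<Longrightarrow> upper (ext_valuation V w (Const c)) = c"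
    and "fuzzy_formula \<sigma> (Neg F) \<Longrightarrow>
      lower (ext_valuation V w (Neg F)) = 1 - lower (ext_valuation V There F)"
    and "fuzzy_formula \<sigma> (Neg F) \<Longrightarrow>
      upper (ext_valuation V w (Neg F)) = 1 - lower (ext_valuation V w F)"
    and "fuzzy_formula \<sigma> (Conj f F G) \<Longrightarrow> lower (ext_valuation V w (Conj f F G)) =
      f (lower (ext_valuation V w F)) (lower (ext_valuation V w G))"
    and "fuzzy_formula \<sigma> (Conj f F G) \<Longrightarrow> upper (ext_valuation V w (Conj f F G)) =
      f (upper (ext_valuation V w F)) (upper (ext_valuation V w G))"
    and "fuzzy_formula \<sigma> (Disj f F G) \<Longrightarrow> lower (ext_valuation V w (Disj f F G)) =
      f (lower (ext_valuation V w F)) (lower (ext_valuation V w G))"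
    and "fuzzy_formula \<sigma> (Disj f F G) \<Longrightarrow> upper (ext_valuation V w (Disj f F G)) =
      f (upper (ext_valuation V w F)) (upper (ext_valuation V w G))"
    and "fuzzy_formula \<sigma> (Imp f F G) \<Longrightarrow> lower (ext_valuation V Here (Imp f F G)) =
      min (f (lower (ext_valuation V Here F)) (lower (ext_valuation V Here G)))
          (f (lower (ext_valuation V There F)) (lower (ext_valuation V There G)))"
    and "fuzzy_formula \<sigma> (Imp f F G) \<Longrightarrow> lower (ext_valuation V There (Imp f F G)) =
      f (lower (ext_valuation V There F)) (lower (ext_valuation V There G))"
    and "fuzzy_formula \<sigma> (Imp f F G) \<Longrightarrow> upper (ext_valuation V w (Imp f F G)) =
      f (lower (ext_valuation V w F)) (upper (ext_valuation V w G))"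
proof -
  note nested = ext_valuation_nested[OF V]
  show "lower (ext_valuation V w (Const c)) = c"
    "upper (ext_valuation V w (Const c)) = c"
    if "fuzzy_formula \<sigma> (Const c)"
    by (simp_all add: lower_upper_Interval)
  show "lower (ext_valuation V w (Neg F)) = 1 - lower (ext_valuation V There F)"
    "upper (ext_valuation V w (Neg F)) = 1 - lower (ext_valuation V w F)"
    if "fuzzy_formula \<sigma> (Neg F)"
    using nested[of F] that by (cases w; simp add: lower_upper_Interval)+
  show "lower (ext_valuation V w (Conj f F G)) =
      f (lower (ext_valuation V w F)) (lower (ext_valuation V w G))"
    "upper (ext_valuation V w (Conj f F G)) =
      f (upper (ext_valuation V w F)) (upper (ext_valuation V w G))"
    if "fuzzy_formula \<sigma> (Conj f F G)"
    using fuzzy_conj_chain[of f, OF _ nested[of F] nested[of G]] that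
    by (cases w; simp add: lower_upper_Interval min.coboundedI1)+
  show "lower (ext_valuation V w (Disj f F G)) =
      f (lower (ext_valuation V w F)) (lower (ext_valuation V w G))"
    "upper (ext_valuation V w (Disj f F G)) =
      f (upper (ext_valuation V w F)) (upper (ext_valuation V w G))"
    if "fuzzy_formula \<sigma> (Disj f F G)"
    using fuzzy_disj_chain[of f, OF _ nested[of F] nested[of G]] that
    by (cases w; simp add: lower_upper_Interval min.coboundedI1)+
  show "lower (ext_valuation V Here (Imp f F G)) =
      min (f (lower (ext_valuation V Here F)) (lower (ext_valuation V Here G)))
          (f (lower (ext_valuation V There F)) (lower (ext_valuation V There G)))"
    "lower (ext_valuation V There (Imp f F G)) =
      f (lower (ext_valuation V There F)) (lower (ext_valuation V There G))"
    "upper (ext_valuation V w (Imp f F G)) =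
      f (lower (ext_valuation V w F)) (upper (ext_valuation V w G))"
    if "fuzzy_formula \<sigma> (Imp f F G)"
    using fuzzy_imp_chain[of f, OF _ nested[of F] nested[of G]] that
    by (cases w; simp add: lower_upper_Interval min.coboundedI1)+
qed

end

(* Lower bounds of the extended valuation depend only on the lower bounds of the atoms, and they are
   exactly the truth values of stable model semantics: the lower bound at There is the value of F
   under the lower-bound interpretation I at There, and the lower bound at Here is the value of the
   reduct of F with respect to I under the lower-bound interpretation J at Here. Upper bounds play
   no role in being a model, so h-minimality pushes them to 1, and what remains of it is the
   minimality condition on J in the definition of stable models. *)

theory Submission
  imports Defs
begin

section \<open>Lower bounds of formulas as truth values\<close>

definition lower_interp :: "'a set \<Rightarrow> (world \<times> 'a \<Rightarrow> real interval) \<Rightarrow> world \<Rightarrow> 'a \<Rightarrow> real" where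
  "lower_interp \<sigma> V w = (\<lambda>p\<in>\<sigma>. lower (V (w, p)))"

lemma lower_interp_apply [simp]: "p \<in> \<sigma> \<Longrightarrow> lower_interp \<sigma> V w p = lower (V (w, p))"
  by (simp add: lower_interp_def)

lemma interp_of_valuation_eq: "interp_of_valuation \<sigma> V = lower_interp \<sigma> V Here"
  by (simp add: interp_of_valuation_def lower_interp_def)

lemma valuation_bounds:
  assumes "V \<in> valuations \<sigma>" "p \<in> \<sigma>"
  shows "0 \<le> lower (V (w, p))" "lower (V (w, p)) \<le> 1" "upper (V (w, p)) \<le> 1"
    and "lower (V (Here, p)) \<le> lower (V (There, p))"
proof -
  have nested: "0 \<le> lower (V (Here, p)) \<and> lower (V (Here, p)) \<le> lower (V (There, p)) \<and>
      lower (V (There, p)) \<le> upper (V (There, p)) \<and>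
      upper (V (There, p)) \<le> upper (V (Here, p)) \<and> upper (V (Here, p)) \<le> 1"
    using ext_valuation_nested[OF assms(1), of "Atom p"] assms(2) by simp
  then show "lower (V (Here, p)) \<le> lower (V (There, p))" by blast
  have "0 \<le> lower (V (w, p)) \<and> lower (V (w, p)) \<le> 1 \<and> upper (V (w, p)) \<le> 1"
  proof (cases w)
    case Here
    show ?thesis using nested unfolding Here by linarith
  next
    case There
    show ?thesis using nested unfolding There by linarith
  qed
  then show "0 \<le> lower (V (w, p))" "lower (V (w, p)) \<le> 1" "upper (V (w, p)) \<le> 1"
    by blast+
qed

lemma lower_interp_in_interpretations:
  "V \<in> valuations \<sigma> \<Longrightarrow> lower_interp \<sigma> V w \<in> interpretations \<sigma>"
  unfolding interpretations_def lower_interp_def by (auto intro: valuation_bounds)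

text \<open>The recursion for lower bounds at \<open>There\<close> refers only to lower bounds at
  \<open>There\<close>, even for negation and the premise of an implication, so it agrees clause by
  clause with \<open>truth_value\<close>.\<close>

lemma lower_ext_valuation_There:
  assumes V: "V \<in> valuations \<sigma>" and F: "fuzzy_formula \<sigma> F"
  shows "lower (ext_valuation V There F) = truth_value (lower_interp \<sigma> V There) F"
  using F
proof (induction F)
  case (Atom p)
  then show ?case by simp
next
  case (Imp f F G)
  then show ?case using ext_valuation_bounds(10)[OF V Imp.prems] by simp
qed (simp_all add: ext_valuation_bounds[OF V] del: ext_valuation.simps)

text \<open>A negation has the same lower bound in both worlds, which is the constant that the
  reduct puts in its place. For an implication the second argument of \<open>min\<close> in the
  clause at \<open>Here\<close> is the constant conjoined by the reduct.\<close>

lemma lower_ext_valuation_Here: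
  assumes V: "V \<in> valuations \<sigma>" and F: "fuzzy_formula \<sigma> F"
  shows "lower (ext_valuation V Here F) =
    truth_value (lower_interp \<sigma> V Here) (reduct (lower_interp \<sigma> V There) F)"
  using F
proof (induction F)
  case (Atom p)
  then show ?case by simp
next
  case (Const c)
  then show ?case by (simp add: lower_upper_Interval)
next
  case (Neg F)
  then show ?case
    using ext_valuation_bounds(3)[OF V Neg.prems] lower_ext_valuation_There[OF V, of F]
    by (simp del: ext_valuation.simps)
next
  case (Conj f F G)
  \<comment> \<open>The clause at \<open>Here\<close> has no \<open>min\<close> to match the one in
    the reduct. Nestedness of the two intervals makes the latter harmless: the value at
    \<open>There\<close> is already the larger one. The same holds for disjunctions.\<close>
  have "lower (ext_valuation V Here (Conj f F G)) \<le> lower (ext_valuation V There (Conj f F G))"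
    using ext_valuation_nested[OF V Conj.prems] by blast
  with Conj show ?case
    using ext_valuation_bounds(5)[OF V Conj.prems] lower_ext_valuation_There[OF V Conj.prems]
    by (simp del: ext_valuation.simps)
next
  case (Disj f F G)
  have "lower (ext_valuation V Here (Disj f F G)) \<le> lower (ext_valuation V There (Disj f F G))"
    using ext_valuation_nested[OF V Disj.prems] by blast
  with Disj show ?case
    using ext_valuation_bounds(7)[OF V Disj.prems] lower_ext_valuation_There[OF V Disj.prems]
    by (simp del: ext_valuation.simps)
next
  case (Imp f F G)
  then show ?case
    using ext_valuation_bounds(9,10)[OF V Imp.prems] lower_ext_valuation_There[OF V Imp.prems]
    by (simp del: ext_valuation.simps)
qed

text \<open>Separates the two worlds: \<open>There\<close> fixes the reduct, and \<open>Here\<close>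
  has to satisfy it.\<close>

lemma eq_model_iff:
  assumes "fuzzy_formula \<sigma> F"
  shows "eq_model \<sigma> F V \<longleftrightarrow> V \<in> valuations \<sigma> \<and>
    satisfies (lower_interp \<sigma> V Here) (reduct (lower_interp \<sigma> V There) F)"
  using lower_ext_valuation_Here[OF _ assms] by (auto simp: eq_model_def satisfies_def)

section \<open>Competing valuations built from competing interpretations\<close>

text \<open>Turns a competitor \<open>J\<close> of a stable model into a competitor of
  \<open>V\<close> for h-minimality. The upper bound 1 makes the interval at \<open>Here\<close> the
  widest one with lower bound \<open>J p\<close>.\<close>

definition widen :: "'a set \<Rightarrow> ('a \<Rightarrow> real) \<Rightarrow> (world \<times> 'a \<Rightarrow> real interval) \<Rightarrow>
    world \<times> 'a \<Rightarrow> real interval" where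
  "widen \<sigma> J V = (\<lambda>x\<in>UNIV \<times> \<sigma>. if fst x = Here then Interval (J (snd x), 1) else V x)"

lemma widen_apply:
  assumes "p \<in> \<sigma>"
  shows "widen \<sigma> J V (Here, p) = Interval (J p, 1)" "widen \<sigma> J V (There, p) = V (There, p)"
  using assms by (simp_all add: widen_def)

lemma widen_in_valuations:
  assumes V: "V \<in> valuations \<sigma>" and J: "J \<in> interpretations \<sigma>"
    and le: "\<forall>p\<in>\<sigma>. J p \<le> lower (V (There, p))"
  shows "widen \<sigma> J V \<in> valuations \<sigma>"
proof -
  have J01: "0 \<le> J p" "J p \<le> 1" if "p \<in> \<sigma>" for p
    using J that by (auto simp: interpretations_def PiE_iff)
  have "set_of (widen \<sigma> J V (w, p)) \<subseteq> {0..1}" if "p \<in> \<sigma>" for w p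
    using that J01[OF that] valuation_bounds[OF V that]
    by (cases w) (simp_all add: widen_apply set_of_eq lower_upper_Interval)
  then have "widen \<sigma> J V \<in> (UNIV \<times> \<sigma>) \<rightarrow>\<^sub>E {i. set_of i \<subseteq> {0..1}}"
    by (auto simp: PiE_iff widen_def extensional_def)
  moreover have "set_of (widen \<sigma> J V (There, a)) \<subseteq> set_of (widen \<sigma> J V (Here, a))"
    if "a \<in> \<sigma>" for a
    using that J01[OF that] le valuation_bounds(3)[OF V that]
    by (simp add: widen_apply set_of_eq lower_upper_Interval)
  ultimately show ?thesis by (simp add: valuations_def)
qed

lemma lower_interp_widen:
  assumes "J \<in> interpretations \<sigma>"
  shows "lower_interp \<sigma> (widen \<sigma> J V) Here = J"
    and "lower_interp \<sigma> (widen \<sigma> J V) There = lower_interp \<sigma> V There"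
proof -
  show "lower_interp \<sigma> (widen \<sigma> J V) Here = J"
    using assms
    \<comment> \<open>With \<open>UNIV\<close> as codomain, only extensionality and agreement on
      \<sigma> remain to be shown.\<close>
    by (intro PiE_ext[of _ \<sigma> "\<lambda>_. UNIV"])
      (auto simp: interpretations_def PiE_iff widen_apply lower_upper_Interval lower_interp_def)
  show "lower_interp \<sigma> (widen \<sigma> J V) There = lower_interp \<sigma> V There"
    by (auto simp: lower_interp_def widen_apply)
qed

text \<open>Being smaller in \<open>val_preceq\<close> means having wider intervals at
  \<open>Here\<close>. Since no upper bound exceeds 1, comparing lower bounds suffices.\<close>

lemma val_preceq_widen:
  assumes V: "V \<in> valuations \<sigma>" and le: "\<forall>p\<in>\<sigma>. J p \<le> lower (V (Here, p))"
  shows "val_preceq \<sigma> (widen \<sigma> J V) V"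
proof -
  have "J p \<le> 1" if "p \<in> \<sigma>" for p
    using le valuation_bounds(2)[OF V that] that by (meson order_trans)
  then show ?thesis
    using le valuation_bounds(3)[OF V]
    by (simp add: val_preceq_def widen_apply set_of_eq lower_upper_Interval)
qed

text \<open>The widened valuation is again a model and lies below \<open>V\<close>, so h-minimality
  forbids it to differ from \<open>V\<close>. An arbitrary \<open>J\<close> yields uniqueness of the
  lower bounds; taking for \<open>J\<close> the lower bounds of \<open>V\<close> itself yields the
  upper bounds.\<close>

lemma equilibrium_widen_eq:
  assumes F: "fuzzy_formula \<sigma> F" and eq: "fuzzy_equilibrium_model \<sigma> F V"
    and J: "J \<in> interpretations \<sigma>" "\<forall>p\<in>\<sigma>. J p \<le> lower (V (Here, p))"
    and sat: "satisfies J (reduct (lower_interp \<sigma> V There) F)"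
  shows "widen \<sigma> J V = V"
proof -
  have V: "V \<in> valuations \<sigma>" and ht: "\<forall>a\<in>\<sigma>. V (Here, a) = V (There, a)"
    and min: "\<And>V'. eq_model \<sigma> F V' \<Longrightarrow> \<not> val_prec \<sigma> V' V"
    using eq by (auto simp: fuzzy_equilibrium_model_def h_minimal_model_def eq_model_def)
  have "widen \<sigma> J V \<in> valuations \<sigma>"
    using widen_in_valuations[OF V J(1)] J(2) ht by simp
  then have "eq_model \<sigma> F (widen \<sigma> J V)"
    using sat by (simp add: eq_model_iff[OF F] lower_interp_widen[OF J(1)])
  with min val_preceq_widen[OF V J(2)] show ?thesis by (auto simp: val_prec_def)
qed

section \<open>Equilibrium models versus stable models\<close>

text \<open>Evaluated at \<open>I\<close> itself, each \<open>min\<close> in the reduct compares two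
  equal values. This links the models of equilibrium logic, which satisfy the reduct, to stable
  models, which satisfy \<open>F\<close>.\<close>

lemma truth_value_reduct_self: "truth_value I (reduct I F) = truth_value I F"
  by (induction F) simp_all

lemma equilibrium_imp_stable:
  assumes F: "fuzzy_formula \<sigma> F" and eq: "fuzzy_equilibrium_model \<sigma> F V"
  shows "stable_model \<sigma> F (interp_of_valuation \<sigma> V)"
    and "p \<in> \<sigma> \<Longrightarrow> upper (V (Here, p)) = 1"
proof -
  let ?I = "lower_interp \<sigma> V Here"
  have ht: "\<forall>a\<in>\<sigma>. V (Here, a) = V (There, a)" and m: "eq_model \<sigma> F V"
    using eq by (auto simp: fuzzy_equilibrium_model_def h_minimal_model_def)
  have V: "V \<in> valuations \<sigma>" using m by (simp add: eq_model_def)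
  have t: "lower_interp \<sigma> V There = ?I"
    using ht by (auto simp: lower_interp_def)
  have I: "?I \<in> interpretations \<sigma>" by (rule lower_interp_in_interpretations[OF V])
  have sat: "satisfies ?I (reduct ?I F)"
    using m by (simp add: eq_model_iff[OF F] t)
  \<comment> \<open>\<open>J\<close> can be read off from its widening as the lower bounds at
    \<open>Here\<close>, and that widening is \<open>V\<close>.\<close>
  have "J = ?I"
    if "J \<in> interpretations \<sigma>" "\<forall>p\<in>\<sigma>. J p \<le> ?I p" "satisfies J (reduct ?I F)" for J
    using equilibrium_widen_eq[OF F eq that(1)] lower_interp_widen(1)[OF that(1), of V] that t
    by simp
  then show "stable_model \<sigma> F (interp_of_valuation \<sigma> V)"
    using I sat unfolding stable_model_def interp_of_valuation_eq satisfies_def truth_value_reduct_self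
    by blast
  \<comment> \<open>This widening keeps the lower bounds of \<open>V\<close> and raises all upper
    bounds at \<open>Here\<close> to 1, so they were 1 before.\<close>
  have "widen \<sigma> ?I V = V"
    by (rule equilibrium_widen_eq[OF F eq I]) (simp_all add: t sat)
  then show "upper (V (Here, p)) = 1" if "p \<in> \<sigma>"
    using widen_apply(1)[OF that, of ?I V] that valuation_bounds(2)[OF V that]
    by (metis lower_interp_apply lower_upper_Interval(2))
qed

text \<open>A model \<open>V'\<close> below \<open>V\<close> agrees with it at \<open>There\<close>,
  hence gives the same reduct. Its lower bounds at \<open>Here\<close> satisfy that reduct and lie
  below those of \<open>V\<close>, so stability makes them equal; upper bounds equal to 1 cannot
  grow.\<close>

lemma stable_imp_equilibrium:
  assumes F: "fuzzy_formula \<sigma> F" and V: "V \<in> valuations \<sigma>"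
    and ht: "\<forall>p\<in>\<sigma>. lower (V (Here, p)) = lower (V (There, p))"
    and up: "\<forall>p\<in>\<sigma>. upper (V (Here, p)) = 1 \<and> upper (V (There, p)) = 1"
    and st: "stable_model \<sigma> F (interp_of_valuation \<sigma> V)"
  shows "fuzzy_equilibrium_model \<sigma> F V"
proof -
  let ?I = "lower_interp \<sigma> V Here"
  have t: "lower_interp \<sigma> V There = ?I"
    using ht by (auto simp: lower_interp_def)
  have m: "eq_model \<sigma> F V"
    using st V by (simp add: eq_model_iff[OF F] t stable_model_def interp_of_valuation_eq
        satisfies_def truth_value_reduct_self)
  have "V' = V" if m': "eq_model \<sigma> F V'" and pre: "val_preceq \<sigma> V' V" for V'
  proof -
    let ?J = "lower_interp \<sigma> V' Here"
    have V': "V' \<in> valuations \<sigma>" using m' by (simp add: eq_model_def)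
    have t': "lower_interp \<sigma> V' There = ?I"
      unfolding t[symmetric] using pre by (auto simp: lower_interp_def val_preceq_def)
    \<comment> \<open>The interval of \<open>V'\<close> contains that of \<open>V\<close>, whose
      upper bound is 1, and stays inside the unit interval.\<close>
    have incl: "lower (V' (Here, p)) \<le> lower (V (Here, p))" "upper (V' (Here, p)) = 1"
      if "p \<in> \<sigma>" for p
      using pre up that valuation_bounds(3)[OF V' that, of Here] lower_le_upper[of "V (Here, p)"]
      by (auto simp: val_preceq_def set_of_eq intro!: antisym)
    have "satisfies ?J (reduct ?I F)"
      using m' by (simp add: eq_model_iff[OF F] t')
    with st incl(1) have J: "?J = ?I"
      using lower_interp_in_interpretations[OF V', of Here]
      unfolding stable_model_def interp_of_valuation_eq by auto
    have "V' (w, p) = V (w, p)" if "p \<in> \<sigma>" for w p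
    proof (cases w)
      case Here
      have "lower (V' (Here, p)) = lower (V (Here, p))"
        using fun_cong[OF J, of p] that by simp
      then show ?thesis using Here incl(2)[OF that] up that by (simp add: interval_eq_iff)
    next
      case There
      then show ?thesis using pre that by (simp add: val_preceq_def)
    qed
    \<comment> \<open>Both valuations are extensional, so agreement on \<sigma> in both worlds is
      enough.\<close>
    then show "V' = V"
      using V V' by (intro PiE_ext[of _ "UNIV \<times> \<sigma>" "\<lambda>_. {i. set_of i \<subseteq> {0..1}}"])
        (auto simp: valuations_def)
  qed
  with m have "h_minimal_model \<sigma> F V"
    by (auto simp: h_minimal_model_def val_prec_def)
  then show ?thesis
    using ht up by (simp add: fuzzy_equilibrium_model_def interval_eq_iff)
qed

text \<open>The intervals from \<open>I p\<close> to 1, the same in both worlds, meet the side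
  conditions of the first claim of the theorem. This lets the second claim be derived from the same
  two implications.\<close>

lemma ex_valuation_of_interpretation:
  assumes "I \<in> interpretations \<sigma>"
  obtains V where "V \<in> valuations \<sigma>" "I = interp_of_valuation \<sigma> V"
    "\<forall>p\<in>\<sigma>. lower (V (Here, p)) = lower (V (There, p)) \<and>
      upper (V (Here, p)) = 1 \<and> upper (V (There, p)) = 1"
proof
  let ?V = "\<lambda>x\<in>UNIV \<times> \<sigma>. Interval (I (snd x), 1)"
  have I: "0 \<le> I p" "I p \<le> 1" if "p \<in> \<sigma>" for p
    using assms that by (auto simp: interpretations_def PiE_iff)
  show "?V \<in> valuations \<sigma>"
    using I by (auto simp: valuations_def set_of_eq lower_upper_Interval)
  show "I = interp_of_valuation \<sigma> ?V"
    using assms I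
    by (intro PiE_ext[of _ \<sigma> "\<lambda>_. UNIV"])
      (auto simp: interpretations_def PiE_iff interp_of_valuation_def lower_upper_Interval)
  show "\<forall>p\<in>\<sigma>. lower (?V (Here, p)) = lower (?V (There, p)) \<and>
      upper (?V (Here, p)) = 1 \<and> upper (?V (There, p)) = 1"
    using I by (simp add: lower_upper_Interval)
qed

theorem theorem6:
  fixes \<sigma> :: "'a set" and F :: "'a formula"
  assumes "fuzzy_formula \<sigma> F"
  shows "(\<forall>V \<in> valuations \<sigma>.
            fuzzy_equilibrium_model \<sigma> F V \<longleftrightarrow>
              (\<forall>p\<in>\<sigma>. lower (V (Here, p)) = lower (V (There, p)) \<and>
                       upper (V (Here, p)) = 1 \<and> upper (V (There, p)) = 1) \<and>
              stable_model \<sigma> F (interp_of_valuation \<sigma> V))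
       \<and> (\<forall>I \<in> interpretations \<sigma>.
            stable_model \<sigma> F I \<longleftrightarrow>
              (\<exists>V. fuzzy_equilibrium_model \<sigma> F V \<and> I = interp_of_valuation \<sigma> V))"
proof -
  have "fuzzy_equilibrium_model \<sigma> F V \<longleftrightarrow>
      (\<forall>p\<in>\<sigma>. lower (V (Here, p)) = lower (V (There, p)) \<and>
        upper (V (Here, p)) = 1 \<and> upper (V (There, p)) = 1) \<and>
      stable_model \<sigma> F (interp_of_valuation \<sigma> V)" if "V \<in> valuations \<sigma>" for V
  proof
    assume eq: "fuzzy_equilibrium_model \<sigma> F V"
    \<comment> \<open>Oriented so that simplification moves every bound to \<open>Here\<close>,
      where \<open>equilibrium_imp_stable\<close> gives the upper bound.\<close>
    then have "\<forall>p\<in>\<sigma>. V (There, p) = V (Here, p)"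
      by (simp add: fuzzy_equilibrium_model_def)
    then show "(\<forall>p\<in>\<sigma>. lower (V (Here, p)) = lower (V (There, p)) \<and>
        upper (V (Here, p)) = 1 \<and> upper (V (There, p)) = 1) \<and>
      stable_model \<sigma> F (interp_of_valuation \<sigma> V)"
      using equilibrium_imp_stable[OF assms eq] by simp
  qed (use stable_imp_equilibrium[OF assms that] in blast)
  moreover have "stable_model \<sigma> F I \<longleftrightarrow>
      (\<exists>V. fuzzy_equilibrium_model \<sigma> F V \<and> I = interp_of_valuation \<sigma> V)"
    if I: "I \<in> interpretations \<sigma>" for I
  proof
    assume st: "stable_model \<sigma> F I"
    obtain V where V: "V \<in> valuations \<sigma>" "I = interp_of_valuation \<sigma> V"
      "\<forall>p\<in>\<sigma>. lower (V (Here, p)) = lower (V (There, p)) \<and>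
        upper (V (Here, p)) = 1 \<and> upper (V (There, p)) = 1"
      using ex_valuation_of_interpretation[OF I] by metis
    then show "\<exists>V. fuzzy_equilibrium_model \<sigma> F V \<and> I = interp_of_valuation \<sigma> V"
      using stable_imp_equilibrium[OF assms V(1)] st by blast
  qed (use equilibrium_imp_stable(1)[OF assms] in blast)
  ultimately show ?thesis by blast
qed

end
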